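(* Let $K\subset S^3$ be a knot with Alexander polynomial $\Delta_K(t)\in\Lambda=\mathbf{Z}[t,t^{-1}]$. Then the group $\mathbf{Z}\ltimes\Delta_K(t)^{-1}\Lambda/\Lambda$ is residually finite.
   Context: $\Delta_K(t)^{-1}\Lambda/\Lambda$ is the $\Lambda$-submodule of $\mathbf{Q}(t)/\Lambda$ consisting of classes of elements $\Delta_K(t)^{-1}f$ with $f\in\Lambda$. The generator $1\in\mathbf{Z}$ acts on it by multiplication by $t$, which defines the semidirect product $\mathbf{Z}\ltimes\Delta_K(t)^{-1}\Lambda/\Lambda$. A group $G$ is called residually finite if there is a sequence of normal subgroups $G\supset G_1\supset G_2\supset\dots$ of finite index in $G$ with $\bigcap_iG_i=\{1\}$. *)

theory Defs
  imports
    "HOL-Homology.Homology"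
    "HOL-Library.Poly_Mapping"
    "HOL-Computational_Algebra.Fraction_Field"
    "HOL-Computational_Algebra.Polynomial"
    "Jordan_Normal_Form.Determinant"
begin

section \<open>Laurent polynomials and rational functions\<close>

text \<open>The ring \<open>\<Lambda> = \<int>[t,t\<^sup>-\<^sup>1]\<close> is the group ring of the integers: a finitely supported function
  \<open>\<int> \<Rightarrow> \<int>\<close> (exponent to coefficient) with convolution as multiplication.\<close>

type_synonym laurent = "int \<Rightarrow>\<^sub>0 int"

text \<open>The field \<open>\<rat>(t)\<close>.\<close>

type_synonym ratfun = "rat poly fract"

definition t_ratfun :: ratfun where
  "t_ratfun = Fract [:0, 1:] 1"

definition ratfun_of_laurent :: "laurent \<Rightarrow> ratfun" where
  "ratfun_of_laurent f =
     (\<Sum>k\<in>Poly_Mapping.keys f. of_int (Poly_Mapping.lookup f k) * t_ratfun powi k)"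


section \<open>Knots and their Alexander polynomials\<close>

abbreviation S3 :: "(real^4) set" where
  "S3 \<equiv> sphere 0 1"

text \<open>A knot is a smooth submanifold of the 3-sphere diffeomorphic to the circle, that is, the
  image of a smooth regular closed curve of period 1 that is injective on a period. The sequence
  \<open>D\<close> consists of the successive derivatives of the parametrisation \<open>D 0\<close>.\<close>

definition knot :: "(real^4) set \<Rightarrow> bool" where
  "knot K \<longleftrightarrow> (\<exists>D :: nat \<Rightarrow> real \<Rightarrow> real^4.
     (\<forall>k s. (D k has_vector_derivative D (Suc k) s) (at s)) \<and>
     (\<forall>s. D 1 s \<noteq> 0) \<and>
     (\<forall>s s'. D 0 s = D 0 s' \<longleftrightarrow> s - s' \<in> \<int>) \<and>
     range (D 0) = K \<and> K \<subseteq> S3)"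

text \<open>A map to the circle inducing an isomorphism on first homology. On a knot complement it is
  unique up to homotopy and complex conjugation.\<close>

definition H1_iso_to_circle :: "'a::topological_space set \<Rightarrow> ('a \<Rightarrow> complex) \<Rightarrow> bool" where
  "H1_iso_to_circle X \<phi> \<longleftrightarrow>
     continuous_on X \<phi> \<and> \<phi> \<in> X \<rightarrow> sphere 0 1 \<and>
     hom_induced 1 (top_of_set X) {} (top_of_set (sphere 0 1)) {} \<phi>
       \<in> iso (homology_group 1 (top_of_set X)) (homology_group 1 (top_of_set (sphere (0::complex) 1)))"

text \<open>The infinite cyclic covering of \<open>X\<close>, as the pullback along \<open>\<phi>\<close> of the universal covering
  \<open>s \<mapsto> exp (2\<pi>is)\<close> of the circle. The group of deck transformations is generated by
  \<open>(x, s) \<mapsto> (x, s + 1)\<close>.\<close>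

definition cyclic_cover :: "'a set \<Rightarrow> ('a \<Rightarrow> complex) \<Rightarrow> ('a \<times> real) set" where
  "cyclic_cover X \<phi> = {(x, s). x \<in> X \<and> \<phi> x = cis (2 * pi * s)}"

definition deck_power :: "int \<Rightarrow> 'a \<times> real \<Rightarrow> 'a \<times> real" where
  "deck_power k = (\<lambda>(x, s). (x, s + of_int k))"

text \<open>The Alexander module \<open>H\<^sub>1(X\<^sub>\<infinity>;\<int>)\<close>. The library writes homology groups multiplicatively, so
  that \<open>\<Sum>k. a\<^sub>k t\<^sup>k \<in> \<Lambda>\<close> sends \<open>h\<close> to the product over \<open>k\<close> of the \<open>a\<^sub>k\<close>-th powers of the images of
  \<open>h\<close> under the \<open>k\<close>-th deck transformation.\<close>

abbreviation alexander_module ::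
    "'a::topological_space set \<Rightarrow> ('a \<Rightarrow> complex) \<Rightarrow> ('a \<times> real) chain set monoid" where
  "alexander_module X \<phi> \<equiv> homology_group 1 (top_of_set (cyclic_cover X \<phi>))"

definition alexander_smult ::
    "'a::topological_space set \<Rightarrow> ('a \<Rightarrow> complex) \<Rightarrow> laurent \<Rightarrow>
     ('a \<times> real) chain set \<Rightarrow> ('a \<times> real) chain set" where
  "alexander_smult X \<phi> a h =
     finprod (alexander_module X \<phi>)
       (\<lambda>k. hom_induced 1 (top_of_set (cyclic_cover X \<phi>)) {} (top_of_set (cyclic_cover X \<phi>)) {}
              (deck_power k) h [^]\<^bsub>alexander_module X \<phi>\<^esub> Poly_Mapping.lookup a k)
       (Poly_Mapping.keys a)"

definition alexander_lincomb ::
    "'a::topological_space set \<Rightarrow> ('a \<Rightarrow> complex) \<Rightarrow> nat \<Rightarrow> (nat \<Rightarrow> laurent) \<Rightarrow>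
     (nat \<Rightarrow> ('a \<times> real) chain set) \<Rightarrow> ('a \<times> real) chain set" where
  "alexander_lincomb X \<phi> n a g =
     finprod (alexander_module X \<phi>) (\<lambda>i. alexander_smult X \<phi> (a i) (g i)) {..<n}"

definition alexander_generators ::
    "'a::topological_space set \<Rightarrow> ('a \<Rightarrow> complex) \<Rightarrow> nat \<Rightarrow>
     (nat \<Rightarrow> ('a \<times> real) chain set) \<Rightarrow> bool" where
  "alexander_generators X \<phi> n g \<longleftrightarrow>
     g \<in> {..<n} \<rightarrow> carrier (alexander_module X \<phi>) \<and>
     (\<forall>h\<in>carrier (alexander_module X \<phi>). \<exists>a. h = alexander_lincomb X \<phi> n a g)"

text \<open>The maximal minors of the presentation matrix of the Alexander module whose rows are all
  relations between the generators \<open>g 0, \<dots>, g (n - 1)\<close>. They generate its order ideal (zeroth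
  Fitting ideal), which does not depend on the generators.\<close>

definition alexander_minors ::
    "'a::topological_space set \<Rightarrow> ('a \<Rightarrow> complex) \<Rightarrow> nat \<Rightarrow>
     (nat \<Rightarrow> ('a \<times> real) chain set) \<Rightarrow> laurent set" where
  "alexander_minors X \<phi> n g =
     {Determinant.det A | A. A \<in> carrier_mat n n \<and>
        (\<forall>i<n. alexander_lincomb X \<phi> n (\<lambda>j. A $$ (i, j)) g = \<one>\<^bsub>alexander_module X \<phi>\<^esub>)}"

definition is_gcd_of :: "'r::comm_ring_1 \<Rightarrow> 'r set \<Rightarrow> bool" where
  "is_gcd_of d E \<longleftrightarrow> (\<forall>e\<in>E. d dvd e) \<and> (\<forall>c. (\<forall>e\<in>E. c dvd e) \<longrightarrow> c dvd d)"

text \<open>The Alexander polynomial is the order of the Alexander module of the knot complement. It is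
  defined up to multiplication by the units \<open>\<plusminus>t\<^sup>k\<close> of \<open>\<Lambda>\<close>, hence a predicate.\<close>

definition alexander_polynomial :: "(real^4) set \<Rightarrow> laurent \<Rightarrow> bool" where
  "alexander_polynomial K \<Delta> \<longleftrightarrow>
     (\<exists>\<phi> n g. H1_iso_to_circle (S3 - K) \<phi> \<and> alexander_generators (S3 - K) \<phi> n g \<and>
        is_gcd_of \<Delta> (alexander_minors (S3 - K) \<phi> n g))"


section \<open>The group \<open>\<int> \<ltimes> \<Delta>\<^sup>-\<^sup>1\<Lambda>/\<Lambda>\<close>\<close>

definition additive_group :: "'a::ab_group_add monoid" where
  "additive_group = \<lparr>carrier = UNIV, monoid.mult = (+), one = 0\<rparr>"

abbreviation laurent_subgroup :: "ratfun set" where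
  "laurent_subgroup \<equiv> range ratfun_of_laurent"

abbreviation ratfun_mod_laurent :: "ratfun set monoid" where
  "ratfun_mod_laurent \<equiv> additive_group Mod laurent_subgroup"

definition inverse_laurent_module :: "laurent \<Rightarrow> ratfun set monoid" where
  "inverse_laurent_module \<Delta> = ratfun_mod_laurent
     \<lparr>carrier := {laurent_subgroup #>\<^bsub>additive_group\<^esub>
                    (inverse (ratfun_of_laurent \<Delta>) * ratfun_of_laurent f) | f. True}\<rparr>"

text \<open>Multiplication by \<open>t\<^sup>n\<close> on \<open>\<rat>(t)/\<Lambda>\<close>; as \<open>t\<close> is a unit of \<open>\<Lambda>\<close>, the image of a coset is a coset.\<close>

definition t_action :: "int \<Rightarrow> ratfun set \<Rightarrow> ratfun set" where
  "t_action n C = (\<lambda>z. t_ratfun powi n * z) ` C"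

definition semidirect_product ::
    "('a, 'c) monoid_scheme \<Rightarrow> ('b, 'd) monoid_scheme \<Rightarrow> ('a \<Rightarrow> 'b \<Rightarrow> 'b) \<Rightarrow> ('a \<times> 'b) monoid" where
  "semidirect_product G H \<theta> =
     \<lparr>carrier = carrier G \<times> carrier H,
      monoid.mult = (\<lambda>(g, x) (h, y). (g \<otimes>\<^bsub>G\<^esub> h, x \<otimes>\<^bsub>H\<^esub> \<theta> g y)),
      one = (\<one>\<^bsub>G\<^esub>, \<one>\<^bsub>H\<^esub>)\<rparr>"

definition alexander_semidirect :: "laurent \<Rightarrow> (int \<times> ratfun set) monoid" where
  "alexander_semidirect \<Delta> =
     semidirect_product integer_group (inverse_laurent_module \<Delta>) t_action"

definition residually_finite :: "('a, 'b) monoid_scheme \<Rightarrow> bool" where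
  "residually_finite G \<longleftrightarrow> group G \<and>
     (\<exists>N :: nat \<Rightarrow> 'a set.
        (\<forall>i. N i \<lhd> G \<and> finite (rcosets\<^bsub>G\<^esub> (N i)) \<and> N (Suc i) \<subseteq> N i) \<and>
        (\<Inter>i. N i) = {\<one>\<^bsub>G\<^esub>})"

end

(* The quotient of Lambda by (Delta) is a residually finite Lambda-module: the ideals
   (Delta, n!, t^(n!) - 1) have finite index and intersect in (Delta). For the intersection write
   Delta = c P with an integer c and P primitive, P(0) nonzero, and let F lie in all these ideals.
   Modulo c and t^N - 1 with N > deg F the polynomial F vanishes, so c divides F. Modulo P and a
   large integer m prime to the outer coefficients of P the powers of t are eventually periodic,
   so (P, m) contains a multiple of t^N - 1 by a power of t; hence the remainder of F by P is
   divisible by m, and it vanishes as m is large. So P divides F, and cP does by Gauss's lemma.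
   The elements (k, v) with n! | k and v in the n-th submodule form the required normal subgroups. *)

theory Submission
  imports Defs
begin

section \<open>Intersections of ideals of integer polynomials\<close>

text \<open>Modulo m the leading coefficient of \<open>P\<close> is a unit, so a nonzero leading
  term of \<open>u\<close> would survive in \<open>u * P\<close> in degree at least
  \<open>degree P\<close>. The induction strips the leading terms of \<open>u\<close> one at a
  time.\<close>

lemma dvd_left_factor_of_coprime_lead_coeff:
  fixes u P :: "int poly"
  assumes "coprime m (lead_coeff P)" and "\<And>i. i \<ge> degree P \<Longrightarrow> m dvd coeff (u * P) i"
  shows "[:m:] dvd u"
  using assms(2)
proof (induction "degree u" arbitrary: u rule: less_induct)
  case less
  have "m dvd lead_coeff u * lead_coeff P"
    using less.prems[of "degree u + degree P"] by (simp add: coeff_mult_degree_sum)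
  then obtain k where k: "lead_coeff u = m * k"
    using assms(1) coprime_dvd_mult_left_iff by blast
  let ?mon = "monom (lead_coeff u) (degree u)"
  have dm: "[:m:] dvd ?mon"
    unfolding k by (simp add: const_poly_dvd_iff)
  show ?case
  proof (cases "degree u = 0")
    case True
    then have "u = ?mon" by (metis degree_0_id monom_0)
    then show ?thesis using dm by simp
  next
    case False
    have "degree (u - ?mon) < degree u"
    proof (cases "u - ?mon = 0")
      case True
      show ?thesis unfolding True using False by simp
    next
      case False
      then show ?thesis
        by (intro degree_less_if_less_eqI) (auto intro!: degree_diff_le degree_monom_le)
    qed
    moreover have "m dvd coeff ((u - ?mon) * P) i" if "i \<ge> degree P" for i
    proof -
      obtain w where "?mon = [:m:] * w" using dm by (auto elim: dvdE)
      then have "coeff (?mon * P) i = m * coeff (w * P) i" by simp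
      then show ?thesis using less.prems[OF that] by (simp add: algebra_simps)
    qed
    ultimately have "[:m:] dvd u - ?mon" by (rule less.hyps)
    then show ?thesis using dm by (metis diff_add_cancel dvd_add)
  qed
qed

text \<open>Modulo m the constant coefficient of \<open>P\<close> is a unit, so the coefficients of
  \<open>u\<close> are determined one after another from the lowest, as in inverting a power
  series.\<close>

lemma dvd_low_coeffs_of_coprime_const_coeff:
  fixes u P :: "int poly"
  assumes "coprime m (coeff P 0)" and "\<And>i. i < s \<Longrightarrow> m dvd coeff (u * P) i" and "i < s"
  shows "m dvd coeff u i"
  using assms(3)
proof (induction i rule: less_induct)
  case (less i)
  have "coeff (u * P) i = coeff u i * coeff P 0 + (\<Sum>j<i. coeff u j * coeff P (i - j))"
    unfolding coeff_mult by (simp add: lessThan_Suc_atMost[symmetric])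
  moreover have "m dvd (\<Sum>j<i. coeff u j * coeff P (i - j))"
    using less by (intro dvd_sum) auto
  ultimately have "m dvd coeff u i * coeff P 0"
    using assms(2)[OF less.prems] by (metis dvd_add_left_iff)
  then show ?case using assms(1) coprime_dvd_mult_left_iff by blast
qed

text \<open>In Z[t]/(P, m) the class of t is not a zero divisor, because \<open>coeff P 0\<close> is
  a unit modulo m, so t^s can be cancelled. As \<open>lead_coeff P\<close> is a unit too, a multiple
  of \<open>P\<close> modulo m of degree below that of \<open>P\<close> is zero modulo m.\<close>

lemma dvd_of_monom_mult_eq:
  fixes F P u v :: "int poly"
  assumes lc: "coprime m (lead_coeff P)" and cc: "coprime m (coeff P 0)"
    and eq: "monom 1 s * F = u * P + smult m v"
    and small: "\<And>i. i \<ge> degree P \<Longrightarrow> coeff F i = 0"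
  shows "[:m:] dvd F"
proof -
  have lowP: "m dvd coeff (u * P) i" if "i < s" for i
  proof -
    have "coeff (monom 1 s * F) i = 0" using that by (simp add: coeff_monom_mult)
    then show ?thesis unfolding eq by (simp add: eq_neg_iff_add_eq_0[symmetric])
  qed
  have low: "m dvd coeff u i" if "i < s" for i
    using dvd_low_coeffs_of_coprime_const_coeff[OF cc lowP that] .
  \<comment> \<open>The part \<open>u0\<close> of \<open>u\<close> below degree s vanishes modulo m,
    so t^s cancels and leaves F congruent to \<open>u' * P\<close>.\<close>
  define u' where "u' = poly_shift s u"
  define u0 where "u0 = poly_cutoff s u"
  have u: "u = monom 1 s * u' + u0"
    by (rule poly_eqI) (auto simp: u'_def u0_def coeff_monom_mult coeff_poly_shift coeff_poly_cutoff)
  have "[:m:] dvd u0"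
    using low by (subst const_poly_dvd_iff) (auto simp: u0_def coeff_poly_cutoff)
  then have "[:m:] dvd u0 * P + [:m:] * v" by (intro dvd_add dvd_mult2 dvd_triv_left)
  also have "\<dots> = monom 1 s * F - monom 1 s * (u' * P)"
    unfolding eq by (subst u) (simp add: algebra_simps)
  finally have "[:m:] dvd \<dots>" .
  then have "m dvd coeff (monom 1 s * (F - u' * P)) (i + s)" for i
    by (simp add: const_poly_dvd_iff right_diff_distrib)
  then have d: "m dvd coeff (F - u' * P) i" for i
    by (simp add: coeff_monom_mult)
  then have "m dvd coeff (u' * P) i" if "i \<ge> degree P" for i
    using small[OF that] d[of i] by simp
  then have "[:m:] dvd u'" by (rule dvd_left_factor_of_coprime_lead_coeff[OF lc])
  then have "[:m:] dvd u' * P" by simp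
  then have "m dvd coeff F i" for i
    using d[of i] by (metis const_poly_dvd_iff coeff_diff diff_add_cancel dvd_add)
  then show ?thesis by (simp add: const_poly_dvd_iff)
qed

section \<open>Finiteness of Z[t]/(P, m) and periodicity of the powers of t\<close>

definition reduced_polys :: "nat \<Rightarrow> int \<Rightarrow> int poly set" where
  "reduced_polys d m = {r. (\<forall>i. coeff r i \<in> {0..<m}) \<and> (\<forall>i\<ge>d. coeff r i = 0)}"

lemma finite_reduced_polys: "finite (reduced_polys d m)"
proof (rule finite_subset)
  show "reduced_polys d m \<subseteq> Poly ` {xs. set xs \<subseteq> {0..<m} \<and> length xs = d}"
  proof
    fix r assume r: "r \<in> reduced_polys d m"
    have "r = Poly (map (coeff r) [0..<d])"
      using r by (intro poly_eqI) (auto simp: reduced_polys_def nth_default_def)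
    then show "r \<in> Poly ` {xs. set xs \<subseteq> {0..<m} \<and> length xs = d}"
      using r by (intro image_eqI[where x = "map (coeff r) [0..<d]"]) (auto simp: reduced_polys_def)
  qed
qed (intro finite_imageI finite_lists_length_eq, simp)

text \<open>Division with remainder by \<open>P\<close> works modulo m because the leading
  coefficient is a unit there. The induction follows Horner's scheme: multiplying a remainder by t
  leaves a single coefficient to clear, the one in degree \<open>degree P\<close>.\<close>

lemma reduce_poly:
  fixes P F :: "int poly"
  assumes "m > 0" and lc: "coprime m (lead_coeff P)"
  shows "\<exists>r u v. r \<in> reduced_polys (degree P) m \<and> F = r + u * P + smult m v"
proof (induction F)
  case 0
  show ?case
    using \<open>m > 0\<close> by (intro exI[of _ 0]) (simp add: reduced_polys_def)
next
  case (pCons a F)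
  then obtain r u v where r: "r \<in> reduced_polys (degree P) m" and F: "F = r + u * P + smult m v"
    by blast
  define g where "g = pCons a r"
  \<comment> \<open>\<open>b\<close> inverts the leading coefficient modulo m, so subtracting
    \<open>\<alpha>\<close> times \<open>P\<close> kills the top coefficient of \<open>g\<close>
    modulo m.\<close>
  obtain b c where bc: "b * lead_coeff P + c * m = 1"
    using lc by (metis bezout_int coprime_commute coprime_imp_gcd_eq_1)
  define \<alpha> where "\<alpha> = coeff g (degree P) * b"
  define h where "h = g - smult \<alpha> P"
  have g0: "coeff g i = 0" if "i > degree P" for i
    using r that by (auto simp: g_def reduced_polys_def coeff_pCons split: nat.split)
  have h0: "m dvd coeff h i" if "i \<ge> degree P" for i
  proof (cases "i = degree P")
    case True
    have "coeff h i = coeff g (degree P) * (1 - b * lead_coeff P)"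
      by (simp add: h_def True \<alpha>_def algebra_simps)
    also have "1 - b * lead_coeff P = c * m" using bc by simp
    finally show ?thesis by simp
  next
    case False
    then show ?thesis using that g0[of i] by (simp add: h_def coeff_eq_0)
  qed
  define r' where "r' = map_poly (\<lambda>x. x mod m) h"
  have cr': "coeff r' i = coeff h i mod m" for i by (simp add: r'_def coeff_map_poly)
  have "[:m:] dvd h - r'"
    by (simp add: const_poly_dvd_iff cr' minus_mod_eq_mult_div)
  then obtain w where w: "h - r' = smult m w" by (auto elim!: dvdE)
  have "pCons a F = g + pCons 0 u * P + smult m (pCons 0 v)"
    unfolding F g_def by simp
  also have "g = r' + smult \<alpha> P + smult m w" using w by (simp add: h_def algebra_simps)
  finally have "pCons a F = r' + (pCons 0 u + [:\<alpha>:]) * P + smult m (pCons 0 v + w)"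
    by (simp add: algebra_simps smult_add_right)
  moreover have "r' \<in> reduced_polys (degree P) m"
    using h0 \<open>m > 0\<close> by (simp add: reduced_polys_def cr')
  ultimately show ?case by blast
qed

lemma monom_minus_1_dvd:
  assumes "M dvd N"
  shows "(monom 1 M - 1 :: 'a::comm_ring_1 poly) dvd monom 1 N - 1"
proof -
  from assms obtain k where "N = M * k" by blast
  then have "monom (1::'a) N - 1 = monom 1 M ^ k - 1" by (simp add: monom_power mult.commute)
  also have "monom 1 M - 1 dvd \<dots>"
    by (simp add: power_diff_1_eq)
  finally show ?thesis .
qed

text \<open>Pigeonhole: the powers of t have only finitely many remainders, so two of them, t^i and
  t^j with i < j, agree modulo \<open>P\<close> and m, and M is j - i.\<close>

lemma monom_periodic_mod:
  fixes P :: "int poly"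
  assumes "m > 0" and "coprime m (lead_coeff P)"
  obtains i M u v where "M > 0" "monom 1 i * (monom 1 M - 1) = u * P + smult m v"
proof -
  obtain r u v where r: "\<And>j. r j \<in> reduced_polys (degree P) m"
    "\<And>j::nat. monom 1 j = r j + u j * P + smult m (v j)"
    using reduce_poly[OF assms, of "monom 1 _"] by metis
  have "finite (range r)"
    using r(1) by (intro finite_subset[OF _ finite_reduced_polys]) auto
  then have "\<not> inj r" using finite_imageD infinite_UNIV_nat by blast
  then obtain i j where "i < j" and eq: "r i = r j"
    by (metis injI linorder_neqE_nat)
  have "monom 1 i * (monom 1 (j - i) - 1) = (monom 1 j - monom 1 i :: int poly)"
    using \<open>i < j\<close> by (simp add: algebra_simps mult_monom)
  also have "\<dots> = (u j - u i) * P + smult m (v j - v i)"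
    unfolding r(2)[of i] r(2)[of j] eq by (simp add: algebra_simps smult_diff_right)
  finally show ?thesis using that \<open>i < j\<close> by (metis zero_less_diff)
qed

section \<open>Divisibility from approximations modulo n! and t^(n!) - 1\<close>

text \<open>Gauss's lemma: the content is multiplicative, so the cofactor of \<open>P\<close> has
  the content of \<open>smult a F\<close> and is itself divisible by \<open>a\<close>.\<close>

lemma dvd_smult_cancel_of_content_1:
  fixes P F :: "int poly"
  assumes "content P = 1" "a \<noteq> 0" "P dvd smult a F"
  shows "P dvd F"
proof -
  obtain q where q: "smult a F = P * q" using assms(3) by blast
  have "content (smult a F) = content q" using assms(1) by (simp add: q content_mult)
  then have "a dvd content q" by (metis content_smult dvd_triv_left normalize_dvd_iff)
  then obtain q' where "q = smult a q'"
    by (auto simp: const_poly_dvd_iff_dvd_content[symmetric] elim!: dvdE)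
  then have "smult a F = smult a (P * q')" using q by simp
  then have "F = P * q'" using \<open>a \<noteq> 0\<close> by (metis smult_cancel)
  then show ?thesis by simp
qed

text \<open>The power \<open>monom 1 s\<close> expresses membership in an ideal of \<Lambda>, where
  t is a unit. A pseudo-remainder of F by \<open>P\<close> inherits these relations modulo
  \<open>P\<close>, and its small degree and bounded coefficients force it to vanish.\<close>

lemma primitive_dvd_of_fact_approximations:
  fixes P F :: "int poly"
  assumes c0: "coeff P 0 \<noteq> 0" and prim: "content P = 1"
    and approx: "\<And>n. \<exists>s u v w. monom 1 s * F
      = u * P + smult (fact n) v + (monom 1 (fact n) - 1) * w"
  shows "P dvd F"
proof -
  define a where "a = lead_coeff P"
  have a0: "a \<noteq> 0" using c0 by (auto simp: a_def)
  \<comment> \<open>The leading coefficient \<open>a\<close> need not be a unit, so only a power of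
    it times F is divided by \<open>P\<close>; Gauss's lemma removes that power at the end.\<close>
  obtain e q r where qr: "smult (a ^ e) F = P * q + r" and deg: "r = 0 \<or> degree r < degree P"
  proof -
    obtain q r where "pseudo_divmod F P = (q, r)" by fastforce
    from pseudo_divmod[OF _ this] that a0 show ?thesis by (auto simp: a_def)
  qed
  txt \<open>Reducing modulo a large integer prime to the outer coefficients of \<open>P\<close> kills \<open>r\<close>.\<close>
  define B where "B = (\<Sum>i\<le>degree r. \<bar>coeff r i\<bar>)"
  \<comment> \<open>The summand 1 makes m prime to both outer coefficients; the factor
    \<open>B + 1\<close> makes m exceed every coefficient of \<open>r\<close> in absolute
    value.\<close>
  define m where "m = \<bar>a * coeff P 0\<bar> * (B + 1) + 1"
  have B0: "B \<ge> 0" by (simp add: B_def sum_nonneg)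
  have "a * coeff P 0 \<noteq> 0" using a0 c0 by simp
  then have "\<bar>a * coeff P 0\<bar> \<ge> 1" by linarith
  then have mB: "m > B" using B0 unfolding m_def
    by (smt (verit) mult_le_cancel_right1)
  then have m0: "m > 0" using B0 by simp
  have cop: "coprime m (a * coeff P 0)"
  proof (rule coprimeI)
    fix d assume "d dvd m" "d dvd a * coeff P 0"
    then show "is_unit d" unfolding m_def
      by (metis dvd_abs_iff dvd_add_right_iff dvd_mult2)
  qed
  then have cop1: "coprime m (lead_coeff P)" and cop2: "coprime m (coeff P 0)"
    by (auto simp: a_def)
  obtain i M u v where M: "M > 0" and per: "monom 1 i * (monom 1 M - 1) = u * P + smult m v"
    using monom_periodic_mod[OF m0 cop1] by metis
  \<comment> \<open>Both M and m divide n! for this n, so the approximation at level n is one modulo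
    m and t^M - 1.\<close>
  define n where "n = max M (nat m)"
  have "M dvd fact n" using M by (intro dvd_fact) (auto simp: n_def)
  then obtain y where y: "monom 1 (fact n) - 1 = (monom 1 M - 1) * (y :: int poly)"
    using monom_minus_1_dvd[of M "fact n"] by (metis dvdE)
  have "nat m dvd fact n" using m0 by (intro dvd_fact) (auto simp: n_def)
  then have "m dvd fact n" using m0 by (metis int_dvd_int_iff int_nat_eq of_nat_fact order_less_imp_le)
  then obtain k where k: "(fact n :: int) = m * k" by blast
  obtain s u' v' w where F: "monom 1 s * F
      = u' * P + smult (fact n) v' + (monom 1 (fact n) - 1) * w"
    using approx[of n] by blast
  \<comment> \<open>The extra factor t^i makes periodicity applicable: it puts the term with t^M - 1
    into the ideal (P, m).\<close>
  have "monom 1 (i + s) * F = monom 1 i * (monom 1 s * F)"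
    by (simp add: mult_monom mult.assoc[symmetric])
  also have "\<dots> = monom 1 i * u' * P + smult m (monom 1 i * smult k v') + monom 1 i * (monom 1 M - 1) * y * w"
    unfolding F y k by (simp add: algebra_simps)
  also have "\<dots> = (monom 1 i * u' + u * y * w) * P + smult m (monom 1 i * smult k v' + v * y * w)"
    unfolding per by (simp add: algebra_simps smult_add_right)
  finally obtain U W where UW: "monom 1 (i + s) * F = U * P + smult m W" by blast
  have "monom 1 (i + s) * r = smult (a ^ e) (monom 1 (i + s) * F) - monom 1 (i + s) * q * P"
    using arg_cong[OF qr, of "\<lambda>x. monom 1 (i + s) * x"] by (simp add: algebra_simps)
  also have "\<dots> = (smult (a ^ e) U - monom 1 (i + s) * q) * P + smult m (smult (a ^ e) W)"
    unfolding UW by (simp add: algebra_simps smult_add_right)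
  finally have eq: "monom 1 (i + s) * r = \<dots>" .
  have "[:m:] dvd r"
    by (rule dvd_of_monom_mult_eq[OF cop1 cop2 eq]) (use deg in \<open>auto simp: coeff_eq_0\<close>)
  then have dv: "m dvd coeff r j" for j by (simp add: const_poly_dvd_iff)
  have "coeff r j = 0" for j
  proof (cases "j \<le> degree r")
    case True
    then have "\<bar>coeff r j\<bar> \<le> B" unfolding B_def
      by (intro member_le_sum) auto
    then show ?thesis using mB dv[of j] by (metis dvd_imp_le_int linorder_not_less order_trans abs_of_pos m0)
  qed (simp add: coeff_eq_0)
  then have "r = 0" by (simp add: poly_eq_iff)
  then have "P dvd smult (a ^ e) F" using qr by simp
  then show ?thesis using dvd_smult_cancel_of_content_1[OF prim] a0 by (metis power_not_zero)
qed

text \<open>Modulo c both D and n! vanish for large n, so F is a multiple of t^(n!) - 1 up to a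
  power of t. That polynomial has outer coefficients 1 and -1, prime to every c, and takes the role
  of \<open>P\<close> in \<open>dvd_of_monom_mult_eq\<close>.\<close>

lemma const_dvd_of_fact_approximations:
  fixes D F :: "int poly"
  assumes c: "c \<noteq> 0" "[:c:] dvd D"
    and approx: "\<And>n. \<exists>s u v w. monom 1 s * F
      = u * D + smult (fact n) v + (monom 1 (fact n) - 1) * w"
  shows "[:c:] dvd F"
proof -
  \<comment> \<open>The first bound gives that c divides n!, the second that n! exceeds the degree
    of F.\<close>
  define n where "n = max (nat \<bar>c\<bar>) (Suc (degree F))"
  have "degree F < n" by (simp add: n_def)
  then have deg: "degree F < fact n" using fact_ge_self[of n] by linarith
  have "nat \<bar>c\<bar> dvd fact n" using c by (intro dvd_fact) (auto simp: n_def)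
  then have "c dvd fact n" by (metis int_dvd_int_iff int_nat_eq of_nat_fact abs_ge_zero abs_dvd_iff)
  then obtain k where k: "(fact n :: int) = c * k" by blast
  obtain d where d: "D = smult c d" using c by (auto elim!: dvdE)
  obtain s u v w where F: "monom 1 s * F = u * D + smult (fact n) v + (monom 1 (fact n) - 1) * w"
    using approx[of n] by blast
  define P :: "int poly" where "P = monom 1 (fact n) - 1"
  have dP: "degree P = fact n"
    unfolding P_def using degree_add_eq_left[of "-1" "monom (1::int) (fact n)"]
    by (simp add: degree_monom_eq)
  have eq: "monom 1 s * F = w * P + smult c (u * d + smult k v)"
    unfolding F k d P_def by (simp add: algebra_simps smult_add_right)
  show ?thesis
    by (rule dvd_of_monom_mult_eq[OF _ _ eq])
      (use deg in \<open>auto simp: dP, auto simp: P_def coeff_eq_0\<close>)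
qed

proposition dvd_of_fact_approximations:
  fixes D F :: "int poly"
  assumes c0: "coeff D 0 \<noteq> 0"
    and approx: "\<And>n. \<exists>s u v w. monom 1 s * F
      = u * D + smult (fact n) v + (monom 1 (fact n) - 1) * w"
  shows "D dvd F"
proof -
  define c where "c = content D"
  define P where "P = primitive_part D"
  have D: "D = smult c P" by (simp add: c_def P_def)
  have D0: "D \<noteq> 0" using c0 by auto
  then have c: "c \<noteq> 0" by (simp add: c_def)
  have prim: "content P = 1" using D0 by (simp add: P_def)
  have "coeff P 0 \<noteq> 0" using c0 by (auto simp: D)
  moreover have "\<exists>s u v w. monom 1 s * F
      = u * P + smult (fact n) v + (monom 1 (fact n) - 1) * w" for n
    using approx[of n] unfolding D by (metis mult_smult_left mult_smult_right)
  ultimately have "P dvd F"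
    using primitive_dvd_of_fact_approximations[OF _ prim] by blast
  then obtain g where g: "F = P * g" by blast
  have "[:c:] dvd D" by (simp add: const_poly_dvd_iff D)
  then have "[:c:] dvd F" by (rule const_dvd_of_fact_approximations[OF c _ approx])
  \<comment> \<open>As \<open>P\<close> is primitive, F and its cofactor \<open>g\<close> have the
    same content.\<close>
  then have "c dvd content g"
    using prim by (simp add: const_poly_dvd_iff_dvd_content g content_mult)
  then have "[:c:] dvd g" by (simp add: const_poly_dvd_iff_dvd_content)
  then show ?thesis unfolding D g by (metis dvd_refl mult.commute mult_dvd_mono mult_smult_left mult_1 smult_one mult_smult_right)
qed

section \<open>Congruence subgroups of the semidirect product\<close>

text \<open>These are the \<Lambda>-submodules of Q(t): closure under differences gives a subgroup,
  and the powers of t generate \<Lambda> additively.\<close>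

definition t_submodule :: "ratfun set \<Rightarrow> bool" where
  "t_submodule A \<longleftrightarrow> 0 \<in> A \<and> (\<forall>x\<in>A. \<forall>y\<in>A. x - y \<in> A) \<and> (\<forall>k. \<forall>x\<in>A. t_ratfun powi k * x \<in> A)"

lemma t_submoduleD:
  assumes "t_submodule A"
  shows "0 \<in> A" "x \<in> A \<Longrightarrow> y \<in> A \<Longrightarrow> x - y \<in> A" "x \<in> A \<Longrightarrow> t_ratfun powi k * x \<in> A"
    "x \<in> A \<Longrightarrow> - x \<in> A" "x \<in> A \<Longrightarrow> y \<in> A \<Longrightarrow> x + y \<in> A"
proof -
  show "x \<in> A \<Longrightarrow> t_ratfun powi k * x \<in> A"
    using assms by (auto simp: t_submodule_def)
  show 0: "0 \<in> A" and d: "x \<in> A \<Longrightarrow> y \<in> A \<Longrightarrow> x - y \<in> A" for x y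
    using assms by (auto simp: t_submodule_def)
  show n: "x \<in> A \<Longrightarrow> - x \<in> A" for x using d[OF 0] by simp
  show "x \<in> A \<Longrightarrow> y \<in> A \<Longrightarrow> x + y \<in> A" using d[of x "- y"] n by simp
qed

lemma t_ratfun_nonzero: "t_ratfun \<noteq> 0"
  by (simp add: t_ratfun_def eq_fract Zero_fract_def)

abbreviation laurent_coset :: "ratfun \<Rightarrow> ratfun set" where
  "laurent_coset v \<equiv> laurent_subgroup #>\<^bsub>additive_group\<^esub> v"

text \<open>For a submodule V this is Z \<ltimes> (V + \<Lambda>)/\<Lambda>. Keeping V as a set of
  rational functions allows calculation with representatives.\<close>

abbreviation t_semidirect :: "ratfun set \<Rightarrow> (int \<times> ratfun set) monoid" where
  "t_semidirect V \<equiv>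
     semidirect_product integer_group (ratfun_mod_laurent \<lparr>carrier := laurent_coset ` V\<rparr>) t_action"

lemma laurent_coset_eq_image: "laurent_coset v = (\<lambda>x. x + v) ` laurent_subgroup"
  by (auto simp: r_coset_def additive_group_def)

text \<open>That \<Lambda> is a submodule enters as the hypothesis \<open>L\<close>, to be
  discharged once \<Lambda> has been described inside Q(t).\<close>

lemma laurent_coset_eq_iff:
  assumes L: "t_submodule laurent_subgroup"
  shows "laurent_coset v = laurent_coset w \<longleftrightarrow> v - w \<in> laurent_subgroup"
proof
  assume "laurent_coset v = laurent_coset w"
  then have "0 + v \<in> laurent_coset w"
    unfolding laurent_coset_eq_image using t_submoduleD(1)[OF L] by blast
  then show "v - w \<in> laurent_subgroup" unfolding laurent_coset_eq_image by auto
next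
  have *: "laurent_coset v \<subseteq> laurent_coset w" if "v - w \<in> laurent_subgroup" for v w
  proof
    fix y assume "y \<in> laurent_coset v"
    then obtain x where "x \<in> laurent_subgroup" "y = x + v"
      unfolding laurent_coset_eq_image by blast
    then show "y \<in> laurent_coset w" unfolding laurent_coset_eq_image
      using t_submoduleD(5)[OF L _ that] by (intro image_eqI[of _ _ "x + (v - w)"]) auto
  qed
  assume "v - w \<in> laurent_subgroup"
  then show "laurent_coset v = laurent_coset w"
    using * t_submoduleD(4)[OF L, of "v - w"] by (intro equalityI) auto
qed

lemma laurent_coset_0: "laurent_coset 0 = laurent_subgroup"
  by (simp add: laurent_coset_eq_image)

lemma laurent_coset_set_mult:
  assumes L: "t_submodule laurent_subgroup"
  shows "laurent_coset v <#>\<^bsub>additive_group\<^esub> laurent_coset w = laurent_coset (v + w)"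
proof (intro equalityI subsetI)
  fix z assume "z \<in> laurent_coset v <#>\<^bsub>additive_group\<^esub> laurent_coset w"
  then obtain x y where "x \<in> laurent_subgroup" "y \<in> laurent_subgroup" "z = (x + v) + (y + w)"
    unfolding laurent_coset_eq_image by (auto simp: set_mult_def additive_group_def)
  then show "z \<in> laurent_coset (v + w)" unfolding laurent_coset_eq_image
    using t_submoduleD(5)[OF L, of x y] by (intro image_eqI[of _ _ "x + y"]) (auto simp: algebra_simps)
next
  fix z assume "z \<in> laurent_coset (v + w)"
  then obtain x where x: "x \<in> laurent_subgroup" "z = (x + v) + (0 + w)"
    unfolding laurent_coset_eq_image by (auto simp: algebra_simps)
  have "x + v \<in> laurent_coset v" "0 + w \<in> laurent_coset w"
    using x(1) t_submoduleD(1)[OF L] unfolding laurent_coset_eq_image by blast+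
  then show "z \<in> laurent_coset v <#>\<^bsub>additive_group\<^esub> laurent_coset w"
    unfolding x(2) set_mult_def by (auto simp: additive_group_def)
qed

lemma t_action_laurent_coset:
  assumes L: "t_submodule laurent_subgroup"
  shows "t_action k (laurent_coset v) = laurent_coset (t_ratfun powi k * v)"
proof -
  have "(\<lambda>x. t_ratfun powi k * x) ` laurent_subgroup = laurent_subgroup"
  proof (intro equalityI subsetI)
    fix x assume "x \<in> laurent_subgroup"
    then have "t_ratfun powi (- k) * x \<in> laurent_subgroup" by (rule t_submoduleD(3)[OF L])
    then show "x \<in> (\<lambda>x. t_ratfun powi k * x) ` laurent_subgroup"
      by (rule rev_image_eqI) (simp add: t_ratfun_nonzero power_int_minus)
  qed (use t_submoduleD(3)[OF L] in blast)
  then have "laurent_coset (t_ratfun powi k * v)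
      = (\<lambda>x. x + t_ratfun powi k * v) ` (\<lambda>x. t_ratfun powi k * x) ` laurent_subgroup"
    by (simp only: laurent_coset_eq_image)
  then show ?thesis
    unfolding t_action_def laurent_coset_eq_image by (simp add: image_image algebra_simps)
qed

section \<open>Group structure and normal subgroups of finite index\<close>

context
  fixes V :: "ratfun set"
  assumes L: "t_submodule laurent_subgroup" and V: "t_submodule V"
begin

lemma carrier_t_semidirect: "carrier (t_semidirect V) = UNIV \<times> laurent_coset ` V"
  by (simp add: semidirect_product_def)

lemma one_t_semidirect: "\<one>\<^bsub>t_semidirect V\<^esub> = (0, laurent_coset 0)"
  by (simp add: semidirect_product_def FactGroup_def laurent_coset_0)

lemma mult_t_semidirect:
  "(k, laurent_coset v) \<otimes>\<^bsub>t_semidirect V\<^esub> (l, laurent_coset w)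
     = (k + l, laurent_coset (v + t_ratfun powi k * w))"
  by (simp add: semidirect_product_def FactGroup_def t_action_laurent_coset[OF L]
      laurent_coset_set_mult[OF L])

lemma group_t_semidirect: "group (t_semidirect V)"
proof (rule groupI)
  show "x \<otimes>\<^bsub>t_semidirect V\<^esub> y \<in> carrier (t_semidirect V)"
    if "x \<in> carrier (t_semidirect V)" "y \<in> carrier (t_semidirect V)" for x y
    using that t_submoduleD(3,5)[OF V]
    by (auto simp: carrier_t_semidirect mult_t_semidirect)
  show "\<one>\<^bsub>t_semidirect V\<^esub> \<in> carrier (t_semidirect V)"
    using t_submoduleD(1)[OF V] by (auto simp: one_t_semidirect carrier_t_semidirect)
  show "x \<otimes>\<^bsub>t_semidirect V\<^esub> y \<otimes>\<^bsub>t_semidirect V\<^esub> z = x \<otimes>\<^bsub>t_semidirect V\<^esub> (y \<otimes>\<^bsub>t_semidirect V\<^esub> z)"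
    if "x \<in> carrier (t_semidirect V)" "y \<in> carrier (t_semidirect V)" "z \<in> carrier (t_semidirect V)"
    for x y z
    using that by (auto simp: carrier_t_semidirect mult_t_semidirect power_int_add t_ratfun_nonzero
        algebra_simps)
  show "\<one>\<^bsub>t_semidirect V\<^esub> \<otimes>\<^bsub>t_semidirect V\<^esub> x = x" if "x \<in> carrier (t_semidirect V)" for x
    using that by (auto simp: carrier_t_semidirect mult_t_semidirect one_t_semidirect)
  show "\<exists>y\<in>carrier (t_semidirect V). y \<otimes>\<^bsub>t_semidirect V\<^esub> x = \<one>\<^bsub>t_semidirect V\<^esub>"
    if "x \<in> carrier (t_semidirect V)" for x
  proof -
    from that obtain k v where x: "x = (k, laurent_coset v)" "v \<in> V"
      by (auto simp: carrier_t_semidirect)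
    then show ?thesis
      using t_submoduleD(3,4)[OF V]
      by (intro bexI[of _ "(- k, laurent_coset (- (t_ratfun powi (- k) * v)))"])
        (auto simp: carrier_t_semidirect mult_t_semidirect one_t_semidirect)
  qed
qed

lemma inv_t_semidirect:
  assumes "v \<in> V"
  shows "inv\<^bsub>t_semidirect V\<^esub> (k, laurent_coset v)
     = (- k, laurent_coset (- (t_ratfun powi (- k) * v)))"
  using assms t_submoduleD(3,4)[OF V]
  by (intro group.inv_equality[OF group_t_semidirect])
    (auto simp: carrier_t_semidirect mult_t_semidirect one_t_semidirect)

text \<open>For a submodule J containing \<Lambda> this is NZ \<ltimes> J/\<Lambda>. Only one
  representative of the coset is asked to lie in J; if \<Lambda> \<subseteq> J, all of them
  do.\<close>

definition congruence_subgroup :: "nat \<Rightarrow> ratfun set \<Rightarrow> (int \<times> ratfun set) set" where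
  "congruence_subgroup N J = {(k, laurent_coset v) | k v. int N dvd k \<and> v \<in> J}"

text \<open>Conjugation by (l, w) turns (k, v) into (k, t^l v - (t^k w - w)). By \<open>act\<close>
  the multiples of N act trivially on V/J, so the correction term stays in J.\<close>

lemma normal_congruence_subgroup:
  assumes J: "t_submodule J" "J \<subseteq> V"
    and act: "\<And>k v. int N dvd k \<Longrightarrow> v \<in> V \<Longrightarrow> t_ratfun powi k * v - v \<in> J"
  shows "congruence_subgroup N J \<lhd> t_semidirect V"
  unfolding group.normal_inv_iff[OF group_t_semidirect]
proof (intro conjI ballI)
  interpret group "t_semidirect V" by (rule group_t_semidirect)
  show "subgroup (congruence_subgroup N J) (t_semidirect V)"
  proof (rule subgroupI)
    show "congruence_subgroup N J \<subseteq> carrier (t_semidirect V)"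
      using J(2) by (auto simp: congruence_subgroup_def carrier_t_semidirect)
    show "congruence_subgroup N J \<noteq> {}"
      using t_submoduleD(1)[OF J(1)] by (auto simp: congruence_subgroup_def intro!: exI[of _ 0])
    show "inv\<^bsub>t_semidirect V\<^esub> a \<in> congruence_subgroup N J" if "a \<in> congruence_subgroup N J" for a
      using that J(2) t_submoduleD(3,4)[OF J(1)]
      by (fastforce simp: congruence_subgroup_def inv_t_semidirect)
    show "a \<otimes>\<^bsub>t_semidirect V\<^esub> b \<in> congruence_subgroup N J"
      if "a \<in> congruence_subgroup N J" "b \<in> congruence_subgroup N J" for a b
      using that t_submoduleD(3,5)[OF J(1)]
      by (fastforce simp: congruence_subgroup_def mult_t_semidirect)
  qed
next
  fix x h assume "x \<in> carrier (t_semidirect V)" "h \<in> congruence_subgroup N J"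
  then obtain l w k v where x: "x = (l, laurent_coset w)" "w \<in> V"
    and h: "h = (k, laurent_coset v)" "int N dvd k" "v \<in> J"
    by (auto simp: carrier_t_semidirect congruence_subgroup_def)
  have "x \<otimes>\<^bsub>t_semidirect V\<^esub> h \<otimes>\<^bsub>t_semidirect V\<^esub> inv\<^bsub>t_semidirect V\<^esub> x
    = (k, laurent_coset (t_ratfun powi l * v - (t_ratfun powi k * w - w)))"
    unfolding x(1) h(1) inv_t_semidirect[OF x(2)]
    by (simp add: mult_t_semidirect power_int_add power_int_minus t_ratfun_nonzero algebra_simps)
  moreover have "t_ratfun powi l * v - (t_ratfun powi k * w - w) \<in> J"
    using t_submoduleD(2,3)[OF J(1)] act[OF h(2) x(2)] h(3) by blast
  ultimately show "x \<otimes>\<^bsub>t_semidirect V\<^esub> h \<otimes>\<^bsub>t_semidirect V\<^esub> inv\<^bsub>t_semidirect V\<^esub> x \<in> congruence_subgroup N J"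
    using h(2) by (auto simp: congruence_subgroup_def)
qed

text \<open>Reducing k modulo N and v modulo J yields coset representatives (i, r) with 0 \<le> i <
  N and r in R.\<close>

lemma finite_rcosets_congruence_subgroup:
  assumes J: "t_submodule J" "J \<subseteq> V"
    and act: "\<And>k v. int N dvd k \<Longrightarrow> v \<in> V \<Longrightarrow> t_ratfun powi k * v - v \<in> J"
    and "N > 0" and R: "finite R" "\<And>v. v \<in> V \<Longrightarrow> \<exists>r\<in>R. v - r \<in> J"
  shows "finite (rcosets\<^bsub>t_semidirect V\<^esub> (congruence_subgroup N J))"
proof (rule finite_subset)
  interpret group "t_semidirect V" by (rule group_t_semidirect)
  interpret normal "congruence_subgroup N J" "t_semidirect V"
    by (rule normal_congruence_subgroup[OF J act])
  let ?rep = "\<lambda>(i, r). congruence_subgroup N J #>\<^bsub>t_semidirect V\<^esub> (i, laurent_coset r)"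
  show "rcosets\<^bsub>t_semidirect V\<^esub> (congruence_subgroup N J) \<subseteq> ?rep ` ({0..<int N} \<times> R)"
  proof
    fix C assume "C \<in> rcosets\<^bsub>t_semidirect V\<^esub> (congruence_subgroup N J)"
    then obtain k v where v: "v \<in> V"
      and C: "C = congruence_subgroup N J #>\<^bsub>t_semidirect V\<^esub> (k, laurent_coset v)"
      unfolding RCOSETS_def carrier_t_semidirect by blast
    obtain r where r: "r \<in> R" "v - r \<in> J" using R(2)[OF v] by blast
    define i where "i = k mod int N"
    have dvd: "int N dvd k - i" by (simp add: i_def minus_mod_eq_mult_div)
    have "v - (v - r) \<in> V" using t_submoduleD(2)[OF V v] r(2) J(2) by blast
    then have rV: "r \<in> V" by simp
    \<comment> \<open>\<open>w\<close> solves w + t^(k - i) r = v, so that (k - i, w) times (i, r)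
      is (k, v). In this form it is visibly a difference of two elements of J.\<close>
    define w where "w = v - r - (t_ratfun powi (k - i) * r - r)"
    have "w \<in> J" unfolding w_def using r(2) act[OF dvd rV] t_submoduleD(2)[OF J(1)] by blast
    then have "(k - i, laurent_coset w) \<in> congruence_subgroup N J"
      using dvd by (auto simp: congruence_subgroup_def)
    moreover have "(k, laurent_coset v) = (k - i, laurent_coset w) \<otimes>\<^bsub>t_semidirect V\<^esub> (i, laurent_coset r)"
      by (simp add: mult_t_semidirect w_def)
    ultimately have "(k, laurent_coset v) \<in> congruence_subgroup N J #>\<^bsub>t_semidirect V\<^esub> (i, laurent_coset r)"
      unfolding r_coset_def by blast
    then have "?rep (i, r) = C"
      unfolding C using repr_independence[OF _ _ is_subgroup] rV
      by (simp add: carrier_t_semidirect)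
    moreover have "(i, r) \<in> {0..<int N} \<times> R" using r(1) \<open>N > 0\<close> by (simp add: i_def)
    ultimately show "C \<in> ?rep ` ({0..<int N} \<times> R)" by blast
  qed
qed (use R(1) in simp)

text \<open>The factorials are totally ordered by divisibility and only 0 is a multiple of all of
  them, so the first entries shrink to 0 while the sets J n shrink the second entries to
  \<Lambda>.\<close>

proposition residually_finite_t_semidirect:
  fixes J :: "nat \<Rightarrow> ratfun set"
  assumes J: "\<And>n. t_submodule (J n)" "\<And>n. laurent_subgroup \<subseteq> J n" "\<And>n. J n \<subseteq> V"
    and dec: "\<And>n. J (Suc n) \<subseteq> J n"
    and Inter: "(\<Inter>n. J n) \<subseteq> laurent_subgroup"
    and act: "\<And>n k v. int (fact n) dvd k \<Longrightarrow> v \<in> V \<Longrightarrow> t_ratfun powi k * v - v \<in> J n"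
    and fin: "\<And>n. \<exists>R. finite R \<and> (\<forall>v\<in>V. \<exists>r\<in>R. v - r \<in> J n)"
  shows "residually_finite (t_semidirect V)"
  unfolding residually_finite_def
proof (intro conjI exI[of _ "\<lambda>n. congruence_subgroup (fact n) (J n)"] allI group_t_semidirect)
  show "congruence_subgroup (fact n) (J n) \<lhd> t_semidirect V" for n
    by (rule normal_congruence_subgroup[OF J(1,3) act])
  show "finite (rcosets\<^bsub>t_semidirect V\<^esub> congruence_subgroup (fact n) (J n))" for n
  proof -
    obtain R where "finite R" "\<And>v. v \<in> V \<Longrightarrow> \<exists>r\<in>R. v - r \<in> J n" using fin[of n] by blast
    then show ?thesis by (intro finite_rcosets_congruence_subgroup[OF J(1,3) act]) auto
  qed
  have "int (fact n) dvd k" if "int (fact (Suc n)) dvd k" for n k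
    using that by (metis dvd_mult_right fact_Suc of_nat_mult)
  then show "congruence_subgroup (fact (Suc n)) (J (Suc n)) \<subseteq> congruence_subgroup (fact n) (J n)" for n
    using dec[of n] unfolding congruence_subgroup_def by blast
  show "(\<Inter>n. congruence_subgroup (fact n) (J n)) = {\<one>\<^bsub>t_semidirect V\<^esub>}"
  proof (intro equalityI subsetI)
    fix x assume x: "x \<in> (\<Inter>n. congruence_subgroup (fact n) (J n))"
    then obtain k v where kv: "x = (k, laurent_coset v)"
      by (fastforce simp: congruence_subgroup_def)
    \<comment> \<open>Membership supplies a representative \<open>v'\<close> that depends on n;
      since J n contains \<Lambda>, the fixed \<open>v\<close> lies in J n as well.\<close>
    have "int (fact n) dvd k \<and> v \<in> J n" for n
    proof -
      have "x \<in> congruence_subgroup (fact n) (J n)" using x by blast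
      then obtain v' where v': "int (fact n) dvd k" "v' \<in> J n" "laurent_coset v = laurent_coset v'"
        unfolding congruence_subgroup_def kv by blast
      then have "v - v' \<in> J n" using J(2) laurent_coset_eq_iff[OF L] by blast
      then have "v - v' + v' \<in> J n" using t_submoduleD(5)[OF J(1)] v'(2) by blast
      then show ?thesis using v'(1) by simp
    qed
    then have dk: "int (fact n) dvd k" and "v \<in> (\<Inter>n. J n)" for n by blast+
    then have "laurent_coset v = laurent_coset 0"
      using Inter laurent_coset_eq_iff[OF L, of v 0] by auto
    moreover have "k = 0"
    proof (rule ccontr)
      assume "k \<noteq> 0"
      \<comment> \<open>The factorial of |k| + 1 divides k although it is larger than |k|.\<close>
      then have "int (fact (Suc (nat \<bar>k\<bar>))) \<le> \<bar>k\<bar>"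
        using dk[of "Suc (nat \<bar>k\<bar>)"] by (metis dvd_imp_le_int abs_of_nat)
      moreover have "Suc (nat \<bar>k\<bar>) \<le> fact (Suc (nat \<bar>k\<bar>))" by (rule fact_ge_self)
      ultimately show False by linarith
    qed
    ultimately show "x \<in> {\<one>\<^bsub>t_semidirect V\<^esub>}" by (simp add: kv one_t_semidirect)
  next
    fix x assume "x \<in> {\<one>\<^bsub>t_semidirect V\<^esub>}"
    then show "x \<in> (\<Inter>n. congruence_subgroup (fact n) (J n))"
      using t_submoduleD(1)[OF J(1)] unfolding one_t_semidirect congruence_subgroup_def by fastforce
  qed
qed

end

section \<open>Laurent polynomials inside the rational functions\<close>

definition eval_t :: "int poly \<Rightarrow> ratfun" where
  "eval_t F = poly (map_poly of_int F) t_ratfun"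

lemma eval_t_0 [simp]: "eval_t 0 = 0"
  by (simp add: eval_t_def)

lemma eval_t_pCons: "eval_t (pCons a F) = of_int a + t_ratfun * eval_t F"
  by (simp add: eval_t_def map_poly_pCons)

lemma eval_t_add: "eval_t (F + G) = eval_t F + eval_t G"
  by (induction F G rule: poly_induct2) (simp_all add: eval_t_pCons algebra_simps)

lemma eval_t_smult: "eval_t (smult a F) = of_int a * eval_t F"
  by (induction F) (simp_all add: eval_t_pCons algebra_simps)

lemma eval_t_diff: "eval_t (F - G) = eval_t F - eval_t G"
  using eval_t_add[of "F - G" G] by simp

lemma eval_t_mult: "eval_t (F * G) = eval_t F * eval_t G"
  by (induction F) (simp_all add: eval_t_pCons eval_t_add eval_t_smult algebra_simps)

lemma eval_t_monom: "eval_t (monom a n) = of_int a * t_ratfun ^ n"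
  by (induction n) (simp_all add: monom_0 monom_Suc eval_t_pCons)

lemma eval_t_1: "eval_t 1 = 1"
  by (simp add: one_pCons eval_t_pCons)

lemmas eval_t_simps = eval_t_add eval_t_diff eval_t_mult eval_t_smult eval_t_monom eval_t_1

text \<open>Fractions with denominator 1 can be compared by coefficients, which yields the
  injectivity of \<open>eval_t\<close>.\<close>

lemma eval_t_eq_Fract: "eval_t F = Fract (map_poly of_int F) 1"
proof (induction F)
  case 0
  show ?case by (simp add: Zero_fract_def)
next
  case (pCons a F)
  have a: "of_int a = (Fract [:of_int a:] 1 :: ratfun)"
  proof (cases a)
    case (nonneg n)
    then show ?thesis by (simp add: of_nat_fract of_nat_poly)
  next
    case (neg n)
    then show ?thesis by (simp add: of_nat_fract of_nat_poly del: of_nat_Suc)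
  qed
  show ?case
    unfolding eval_t_pCons pCons.IH a by (simp add: t_ratfun_def map_poly_pCons)
qed

lemma eval_t_eq_iff: "eval_t F = eval_t G \<longleftrightarrow> F = G"
  by (auto simp: eval_t_eq_Fract eq_fract poly_eq_iff coeff_map_poly)

section \<open>\<Lambda> as a subring of Q(t)\<close>

lemma ratfun_of_laurent_eq_sum:
  assumes "finite A" "Poly_Mapping.keys f \<subseteq> A"
  shows "ratfun_of_laurent f = (\<Sum>k\<in>A. of_int (Poly_Mapping.lookup f k) * t_ratfun powi k)"
  unfolding ratfun_of_laurent_def using assms
  by (intro sum.mono_neutral_left) (auto simp: in_keys_iff)

lemma ratfun_of_laurent_add: "ratfun_of_laurent (f + g) = ratfun_of_laurent f + ratfun_of_laurent g"
proof -
  let ?A = "Poly_Mapping.keys f \<union> Poly_Mapping.keys g"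
  have "Poly_Mapping.keys (f + g) \<subseteq> ?A" by (rule Poly_Mapping.keys_add)
  then show ?thesis
    by (simp add: ratfun_of_laurent_eq_sum[of ?A] lookup_add algebra_simps sum.distrib)
qed

lemma ratfun_of_laurent_single:
  "ratfun_of_laurent (Poly_Mapping.single k a) = of_int a * t_ratfun powi k"
  by (subst ratfun_of_laurent_eq_sum[of "{k}"]) auto

text \<open>One power of t clears all negative exponents of a Laurent polynomial. Products in
  \<Lambda> are later computed in this form.\<close>

lemma laurent_subgroup_eq: "laurent_subgroup = {t_ratfun powi k * eval_t F | k F. True}"
proof (intro equalityI subsetI)
  fix x assume "x \<in> laurent_subgroup"
  then obtain f where f: "x = ratfun_of_laurent f" by blast
  \<comment> \<open>\<open>s\<close> dominates the absolute value of every exponent in the support,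
    so all shifted exponents are nonnegative.\<close>
  define s where "s = (\<Sum>k\<in>Poly_Mapping.keys f. \<bar>k\<bar>)"
  have s: "k + s \<ge> 0" if "k \<in> Poly_Mapping.keys f" for k
    using member_le_sum[OF that, of "\<lambda>k. \<bar>k\<bar>"] by (simp add: s_def)
  define F where "F = (\<Sum>k\<in>Poly_Mapping.keys f. monom (Poly_Mapping.lookup f k) (nat (k + s)))"
  have ev: "eval_t (\<Sum>k\<in>A. G k) = (\<Sum>k\<in>A. eval_t (G k))" if "finite A" for A and G :: "int \<Rightarrow> int poly"
    using that by induction (simp_all add: eval_t_simps)
  have "t_ratfun powi (- s) * eval_t F = x"
    unfolding f ratfun_of_laurent_def F_def ev[OF finite_keys] sum_distrib_left
  proof (rule sum.cong)
    fix k assume k: "k \<in> Poly_Mapping.keys f"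
    have "t_ratfun powi k = t_ratfun powi (- s) * t_ratfun powi (k + s)"
      by (simp add: t_ratfun_nonzero power_int_add[symmetric])
    also have "t_ratfun powi (k + s) = t_ratfun ^ nat (k + s)"
      using s[OF k] by (rule power_int_nonneg_exp)
    finally show "t_ratfun powi - s * eval_t (monom (Poly_Mapping.lookup f k) (nat (k + s)))
      = of_int (Poly_Mapping.lookup f k) * t_ratfun powi k"
      by (simp add: eval_t_simps)
  qed simp
  then show "x \<in> {t_ratfun powi k * eval_t F | k F. True}" by blast
next
  \<comment> \<open>The exponent k varies in the induction, because t^k (a + t F) = a t^k + t^(k+1)
    F raises it.\<close>
  have "\<exists>f. t_ratfun powi k * eval_t F = ratfun_of_laurent f" for k F
  proof (induction F arbitrary: k)
    case 0
    show ?case by (intro exI[of _ 0]) (simp add: ratfun_of_laurent_def)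
  next
    case (pCons a F)
    obtain f where f: "t_ratfun powi (k + 1) * eval_t F = ratfun_of_laurent f"
      using pCons.IH by blast
    have "t_ratfun powi k * eval_t (pCons a F) = ratfun_of_laurent (Poly_Mapping.single k a + f)"
      unfolding ratfun_of_laurent_add ratfun_of_laurent_single f[symmetric]
      by (simp add: eval_t_pCons power_int_add t_ratfun_nonzero algebra_simps)
    then show ?case by blast
  qed
  then show "x \<in> laurent_subgroup" if "x \<in> {t_ratfun powi k * eval_t F | k F. True}" for x
    using that by blast
qed

lemma laurentI: "t_ratfun powi k * eval_t F \<in> laurent_subgroup"
  unfolding laurent_subgroup_eq by blast

lemma laurentE:
  assumes "x \<in> laurent_subgroup"
  obtains k F where "x = t_ratfun powi k * eval_t F"
  using assms unfolding laurent_subgroup_eq by blast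

lemma eval_t_in_laurent: "eval_t F \<in> laurent_subgroup"
  using laurentI[of 0 F] by simp

lemma of_int_in_laurent: "of_int a \<in> laurent_subgroup"
  using eval_t_in_laurent[of "monom a 0"] by (simp add: eval_t_simps)

lemma one_in_laurent: "1 \<in> laurent_subgroup"
  using of_int_in_laurent[of 1] by simp

lemma laurent_mult:
  assumes "x \<in> laurent_subgroup" "y \<in> laurent_subgroup"
  shows "x * y \<in> laurent_subgroup"
proof -
  obtain k F l G where "x = t_ratfun powi k * eval_t F" "y = t_ratfun powi l * eval_t G"
    using assms by (auto elim!: laurentE)
  then have "x * y = t_ratfun powi (k + l) * eval_t (F * G)"
    by (simp add: eval_t_simps power_int_add t_ratfun_nonzero algebra_simps)
  then show ?thesis using laurentI by simp
qed

lemma t_powi_in_laurent: "t_ratfun powi k \<in> laurent_subgroup"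
  using laurentI[of k 1] by (simp add: eval_t_1)

lemma t_submodule_laurent: "t_submodule laurent_subgroup"
  unfolding t_submodule_def
proof (intro conjI ballI allI)
  show "0 \<in> laurent_subgroup" using of_int_in_laurent[of 0] by simp
  fix x y assume x: "x \<in> laurent_subgroup" and y: "y \<in> laurent_subgroup"
  have "- y \<in> laurent_subgroup" using laurent_mult[OF of_int_in_laurent[of "-1"] y] by simp
  then obtain f g where "x = ratfun_of_laurent f" "- y = ratfun_of_laurent g" using x by blast
  then have "x - y = ratfun_of_laurent (f + g)" by (simp add: ratfun_of_laurent_add)
  then show "x - y \<in> laurent_subgroup" by blast
qed (intro laurent_mult t_powi_in_laurent)

lemmas laurentD = t_submoduleD[OF t_submodule_laurent]

text \<open>A threshold instead of a single exponent lets one power of t serve several elements at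
  once.\<close>

lemma laurent_clear_denominator:
  assumes "x \<in> laurent_subgroup"
  shows "\<exists>s0. \<forall>s\<ge>s0. \<exists>F. t_ratfun ^ s * x = eval_t F"
proof -
  obtain k G where x: "x = t_ratfun powi k * eval_t G" using assms by (rule laurentE)
  have "t_ratfun ^ s * x = eval_t (monom 1 (nat (int s + k)) * G)" if "s \<ge> nat (- k)" for s
  proof -
    have "t_ratfun ^ s * t_ratfun powi k = t_ratfun powi (int s + k)"
      by (simp add: power_int_add t_ratfun_nonzero)
    also have "\<dots> = t_ratfun ^ nat (int s + k)" using that by (intro power_int_nonneg_exp) simp
    finally show ?thesis by (simp add: x eval_t_simps mult.assoc[symmetric])
  qed
  then show ?thesis by blast
qed

text \<open>Factors t are units of \<Lambda> and can be moved out of the polynomial. This secures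
  the condition on the constant coefficient in \<open>dvd_of_fact_approximations\<close>.\<close>

lemma laurent_associate_nonzero_const_coeff:
  assumes "x \<in> laurent_subgroup" "x \<noteq> 0"
  obtains k F where "x = t_ratfun powi k * eval_t F" "coeff F 0 \<noteq> 0"
proof -
  have "\<exists>l G. t_ratfun powi k * eval_t F = t_ratfun powi l * eval_t G \<and> coeff G 0 \<noteq> 0"
    if "F \<noteq> 0" for k F
    using that
  proof (induction F arbitrary: k)
    case (pCons a F)
    show ?case
    proof (cases "a = 0")
      case True
      then have "t_ratfun powi k * eval_t (pCons a F) = t_ratfun powi (k + 1) * eval_t F"
        by (simp add: eval_t_pCons power_int_add t_ratfun_nonzero algebra_simps)
      then show ?thesis using pCons True by auto
    next
      case False
      then show ?thesis by (metis coeff_pCons_0)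
    qed
  qed simp
  moreover obtain k F where "x = t_ratfun powi k * eval_t F" using assms(1) by (rule laurentE)
  moreover have "F \<noteq> 0" using calculation(2) assms(2) by (auto simp: eval_t_simps)
  ultimately show ?thesis using that by metis
qed

section \<open>The ideals generated by \<open>n!\<close> and \<open>t\<^sup>n\<^sup>! - 1\<close>\<close>

definition fact_ideal :: "nat \<Rightarrow> ratfun set" where
  "fact_ideal n = {of_int (fact n) * y + (t_ratfun ^ fact n - 1) * w | y w.
     y \<in> laurent_subgroup \<and> w \<in> laurent_subgroup}"

lemma fact_ideal_subset: "fact_ideal n \<subseteq> laurent_subgroup"
proof -
  have "t_ratfun ^ fact n - 1 \<in> laurent_subgroup"
    using eval_t_in_laurent[of "monom 1 (fact n) - 1"] by (simp add: eval_t_simps)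
  then have "of_int (fact n) * y + (t_ratfun ^ fact n - 1) * w \<in> laurent_subgroup"
    if "y \<in> laurent_subgroup" "w \<in> laurent_subgroup" for y w
    using that by (intro laurentD(5) laurent_mult of_int_in_laurent)
  then show ?thesis unfolding fact_ideal_def by blast
qed

lemma fact_ideal_mult:
  assumes "x \<in> laurent_subgroup" "z \<in> fact_ideal n"
  shows "x * z \<in> fact_ideal n"
proof -
  obtain y w where yw: "y \<in> laurent_subgroup" "w \<in> laurent_subgroup"
    and z: "z = of_int (fact n) * y + (t_ratfun ^ fact n - 1) * w"
    using assms(2) unfolding fact_ideal_def by blast
  have "x * z = of_int (fact n) * (x * y) + (t_ratfun ^ fact n - 1) * (x * w)"
    by (simp add: z algebra_simps)
  then show ?thesis unfolding fact_ideal_def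
    using laurent_mult[OF assms(1) yw(1)] laurent_mult[OF assms(1) yw(2)] by blast
qed

lemma t_submodule_fact_ideal: "t_submodule (fact_ideal n)"
  unfolding t_submodule_def
proof (intro conjI ballI allI)
  show "0 \<in> fact_ideal n" unfolding fact_ideal_def
    using laurentD(1) by (auto intro!: exI[of _ 0])
  fix a b assume "a \<in> fact_ideal n" "b \<in> fact_ideal n"
  then obtain y w y' w' where yw: "y \<in> laurent_subgroup" "w \<in> laurent_subgroup"
      "y' \<in> laurent_subgroup" "w' \<in> laurent_subgroup"
    and ab: "a = of_int (fact n) * y + (t_ratfun ^ fact n - 1) * w"
      "b = of_int (fact n) * y' + (t_ratfun ^ fact n - 1) * w'"
    unfolding fact_ideal_def by blast
  have "a - b = of_int (fact n) * (y - y') + (t_ratfun ^ fact n - 1) * (w - w')"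
    by (simp add: ab algebra_simps)
  then show "a - b \<in> fact_ideal n" unfolding fact_ideal_def 
    using laurentD(2)[OF yw(1,3)] laurentD(2)[OF yw(2,4)] by blast
qed (intro fact_ideal_mult t_powi_in_laurent)

lemma t_power_minus_1_in_fact_ideal: "t_ratfun ^ fact n - 1 \<in> fact_ideal n"
  unfolding fact_ideal_def using laurentD(1) one_in_laurent
  by (intro CollectI exI[of _ 0] exI[of _ 1]) simp

text \<open>Modulo the ideal t^(n!) is 1, hence so are its integer powers. The generator t^(n!) - 1
  is there for this: multiples of n! act trivially on the quotient.\<close>

lemma t_powi_minus_1_in_fact_ideal:
  assumes "int (fact n) dvd k"
  shows "t_ratfun powi k - 1 \<in> fact_ideal n"
proof -
  have nat: "t_ratfun ^ m - 1 \<in> fact_ideal n" if m: "fact n dvd m" for m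
  proof -
    obtain G :: "int poly" where "monom 1 m - 1 = (monom 1 (fact n) - 1) * G"
      using monom_minus_1_dvd[OF m] by (metis dvdE)
    then have "eval_t (monom 1 m - 1) = eval_t ((monom 1 (fact n) - 1) * G)" by (rule arg_cong)
    then have "t_ratfun ^ m - 1 = eval_t G * (t_ratfun ^ fact n - 1)"
      by (simp add: eval_t_simps mult.commute)
    then show ?thesis
      using fact_ideal_mult[OF eval_t_in_laurent t_power_minus_1_in_fact_ideal] by simp
  qed
  have d: "fact n dvd nat \<bar>k\<bar>" using assms by (simp add: dvd_nat_abs_iff)
  show ?thesis
  proof (cases "k \<ge> 0")
    case True
    then show ?thesis using nat[OF d] by (simp add: power_int_nonneg_exp)
  next
    case False
    then have "t_ratfun powi k - 1 = (- (t_ratfun powi k)) * (t_ratfun ^ nat \<bar>k\<bar> - 1)"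
      by (simp add: power_int_nonneg_exp[symmetric] power_int_minus t_ratfun_nonzero algebra_simps)
    then show ?thesis using fact_ideal_mult[OF laurentD(4)[OF t_powi_in_laurent] nat[OF d]] by simp
  qed
qed

text \<open>The generators (n+1)! and t^((n+1)!) - 1 are multiples of n! and t^(n!) - 1.\<close>

lemma fact_ideal_Suc_subset: "fact_ideal (Suc n) \<subseteq> fact_ideal n"
proof
  fix z assume "z \<in> fact_ideal (Suc n)"
  then obtain y w where yw: "y \<in> laurent_subgroup" "w \<in> laurent_subgroup"
    and z: "z = of_int (fact (Suc n)) * y + (t_ratfun ^ fact (Suc n) - 1) * w"
    unfolding fact_ideal_def by blast
  have "of_int (fact n) * (1 :: ratfun) + (t_ratfun ^ fact n - 1) * 0 \<in> fact_ideal n"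
    unfolding fact_ideal_def using laurentD(1) one_in_laurent by blast
  then have "of_int (fact n) \<in> fact_ideal n" by (simp only: mult_1_right mult_zero_right add_0_right)
  then have "(of_int (int (Suc n)) * y) * of_int (fact n) \<in> fact_ideal n"
    by (rule fact_ideal_mult[OF laurent_mult[OF of_int_in_laurent yw(1)]])
  moreover have "w * (t_ratfun powi int (fact (Suc n)) - 1) \<in> fact_ideal n"
    by (intro fact_ideal_mult[OF yw(2)] t_powi_minus_1_in_fact_ideal) simp
  moreover have "z = (of_int (int (Suc n)) * y) * of_int (fact n)
      + w * (t_ratfun powi int (fact (Suc n)) - 1)"
    unfolding z power_int_of_nat by (simp add: algebra_simps)
  ultimately show "z \<in> fact_ideal n" using t_submoduleD(5)[OF t_submodule_fact_ideal] by simp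
qed

text \<open>Division by the monic polynomial t^(n!) - 1 modulo n! leaves finitely many
  remainders.\<close>

lemma laurent_mod_fact_ideal_finite:
  "\<exists>R. finite R \<and> (\<forall>x\<in>laurent_subgroup. \<exists>r\<in>R. x - r \<in> fact_ideal n)"
proof (intro exI conjI ballI)
  let ?P = "monom 1 (fact n) - 1 :: int poly"
  let ?R = "eval_t ` reduced_polys (degree ?P) (fact n)"
  show "finite ?R" by (intro finite_imageI finite_reduced_polys)
  have lc: "lead_coeff ?P = 1"
    using degree_add_eq_left[of "-1" "monom (1::int) (fact n)"] by (simp add: degree_monom_eq)
  fix x assume "x \<in> laurent_subgroup"
  then obtain k F where x: "x = t_ratfun powi k * eval_t F" by (rule laurentE)
  \<comment> \<open>As a multiple of n!, \<open>l\<close> makes t^l equal to 1 modulo the ideal; as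
    it is at least |k|, t^l x is a polynomial in t.\<close>
  define l where "l = int (fact n) * \<bar>k\<bar>"
  have "1 * \<bar>k\<bar> \<le> l" unfolding l_def by (intro mult_right_mono) auto
  then have kl: "k + l \<ge> 0" by simp
  obtain r u v where r: "r \<in> reduced_polys (degree ?P) (fact n)"
    and G: "monom 1 (nat (k + l)) * F = r + u * ?P + smult (fact n) v"
    using reduce_poly[of "fact n" ?P "monom 1 (nat (k + l)) * F"] lc by auto
  have "t_ratfun powi (k + l) = t_ratfun ^ nat (k + l)" using kl by (rule power_int_nonneg_exp)
  then have "t_ratfun powi l * x = eval_t (monom 1 (nat (k + l)) * F)"
    by (simp add: x eval_t_simps power_int_add t_ratfun_nonzero mult_ac)
  also have "\<dots> = eval_t r + (of_int (fact n) * eval_t v + (t_ratfun ^ fact n - 1) * eval_t u)"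
    unfolding G by (simp add: eval_t_simps algebra_simps)
  finally have "x - eval_t r = of_int (fact n) * eval_t v + (t_ratfun ^ fact n - 1) * eval_t u
      - x * (t_ratfun powi l - 1)"
    by (simp add: algebra_simps)
  moreover have "of_int (fact n) * eval_t v + (t_ratfun ^ fact n - 1) * eval_t u \<in> fact_ideal n"
    unfolding fact_ideal_def using eval_t_in_laurent by blast
  moreover have "x * (t_ratfun powi l - 1) \<in> fact_ideal n"
    using \<open>x \<in> laurent_subgroup\<close>
    by (intro fact_ideal_mult t_powi_minus_1_in_fact_ideal) (simp_all add: l_def)
  ultimately have "x - eval_t r \<in> fact_ideal n"
    using t_submoduleD(2)[OF t_submodule_fact_ideal] by simp
  then show "\<exists>r\<in>?R. x - r \<in> fact_ideal n" using r by blast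
qed

text \<open>Up to powers of t both \<open>\<delta>\<close> and \<open>f\<close> are polynomials. A
  further common power of t makes the coefficients of each approximation polynomials too, which
  reduces the claim to \<open>dvd_of_fact_approximations\<close>.\<close>

proposition laurent_dvd_of_fact_ideal:
  assumes \<delta>: "\<delta> \<in> laurent_subgroup" "\<delta> \<noteq> 0" and f: "f \<in> laurent_subgroup"
    and approx: "\<And>n. \<exists>x\<in>laurent_subgroup. f - \<delta> * x \<in> fact_ideal n"
  shows "\<exists>g\<in>laurent_subgroup. f = \<delta> * g"
proof -
  obtain b D where D: "\<delta> = t_ratfun powi b * eval_t D" "coeff D 0 \<noteq> 0"
    using laurent_associate_nonzero_const_coeff[OF \<delta>] .
  obtain a F where F: "f = t_ratfun powi a * eval_t F" using f by (rule laurentE)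
  have "\<exists>s u v w. monom 1 s * F = u * D + smult (fact n) v + (monom 1 (fact n) - 1) * w" for n
  proof -
    obtain x y w where xyw: "x \<in> laurent_subgroup" "y \<in> laurent_subgroup" "w \<in> laurent_subgroup"
      and eq: "f - \<delta> * x = of_int (fact n) * y + (t_ratfun ^ fact n - 1) * w"
      using approx[of n] unfolding fact_ideal_def by blast
    \<comment> \<open>\<open>c\<close> turns f into the polynomial F, while the unit t^b of
      \<open>\<delta>\<close> is absorbed into the coefficient \<open>x\<close>.\<close>
    define c where "c = t_ratfun powi (- a)"
    have c: "c \<in> laurent_subgroup" unfolding c_def by (rule t_powi_in_laurent)
    have cf: "c * f = eval_t F"
      by (simp add: c_def F power_int_minus t_ratfun_nonzero)
    have "c * (t_ratfun powi b * x) \<in> laurent_subgroup" "c * y \<in> laurent_subgroup" "c * w \<in> laurent_subgroup"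
      by (intro laurent_mult c xyw t_powi_in_laurent)+
    note this[THEN laurent_clear_denominator]
    then obtain s1 s2 s3 where
      s: "\<forall>s\<ge>s1. \<exists>U. t_ratfun ^ s * (c * (t_ratfun powi b * x)) = eval_t U"
        "\<forall>s\<ge>s2. \<exists>Y. t_ratfun ^ s * (c * y) = eval_t Y"
        "\<forall>s\<ge>s3. \<exists>W. t_ratfun ^ s * (c * w) = eval_t W"
      by (elim exE)
    define s where "s = s1 + s2 + s3"
    have "s \<ge> s1" "s \<ge> s2" "s \<ge> s3" by (simp_all add: s_def)
    with s obtain U Y W where UYW: "t_ratfun ^ s * (c * (t_ratfun powi b * x)) = eval_t U"
        "t_ratfun ^ s * (c * y) = eval_t Y" "t_ratfun ^ s * (c * w) = eval_t W"
      by metis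
    have f_eq: "f = \<delta> * x + of_int (fact n) * y + (t_ratfun ^ fact n - 1) * w"
      using eq by (simp add: algebra_simps)
    have "t_ratfun ^ s * (c * f) = (t_ratfun ^ s * (c * (t_ratfun powi b * x))) * eval_t D
        + of_int (fact n) * (t_ratfun ^ s * (c * y))
        + (t_ratfun ^ fact n - 1) * (t_ratfun ^ s * (c * w))"
      unfolding f_eq D(1) by (simp add: algebra_simps)
    then have "eval_t (monom 1 s * F) = eval_t (U * D + smult (fact n) Y + (monom 1 (fact n) - 1) * W)"
      unfolding UYW cf by (simp add: eval_t_simps)
    then show ?thesis unfolding eval_t_eq_iff by blast
  qed
  then have "D dvd F" by (rule dvd_of_fact_approximations[OF D(2)])
  then obtain G where G: "F = D * G" by blast
  have "f = \<delta> * (t_ratfun powi (a - b) * eval_t G)"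
    by (simp add: F G D(1) eval_t_simps power_int_diff t_ratfun_nonzero)
  then show ?thesis using laurentI by blast
qed

text \<open>For \<open>\<delta> = 0\<close> this is \<open>\<Lambda>\<close> itself (if \<open>I\<close> is nonempty), since \<open>inverse 0 = 0\<close>.\<close>

definition laurent_extension :: "ratfun \<Rightarrow> ratfun set \<Rightarrow> ratfun set" where
  "laurent_extension \<delta> I = {x + inverse \<delta> * z | x z. x \<in> laurent_subgroup \<and> z \<in> I}"

lemma laurent_extensionI:
  "x \<in> laurent_subgroup \<Longrightarrow> z \<in> I \<Longrightarrow> x + inverse \<delta> * z \<in> laurent_extension \<delta> I"
  unfolding laurent_extension_def by blast

lemma laurent_extensionE:
  assumes "v \<in> laurent_extension \<delta> I"
  obtains x z where "x \<in> laurent_subgroup" "z \<in> I" "v = x + inverse \<delta> * z"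
  using assms unfolding laurent_extension_def by blast

lemma t_submodule_laurent_extension:
  assumes I: "t_submodule I"
  shows "t_submodule (laurent_extension \<delta> I)"
  unfolding t_submodule_def
proof (intro conjI ballI allI)
  show "0 \<in> laurent_extension \<delta> I"
    using laurent_extensionI[OF laurentD(1) t_submoduleD(1)[OF I]] by simp
  fix a assume "a \<in> laurent_extension \<delta> I"
  then obtain x z where a: "x \<in> laurent_subgroup" "z \<in> I" "a = x + inverse \<delta> * z"
    by (rule laurent_extensionE)
  show "a - b \<in> laurent_extension \<delta> I" if b: "b \<in> laurent_extension \<delta> I" for b
  proof -
    obtain x' z' where "x' \<in> laurent_subgroup" "z' \<in> I" "b = x' + inverse \<delta> * z'"
      using b by (rule laurent_extensionE)
    moreover have "a - (x' + inverse \<delta> * z') = (x - x') + inverse \<delta> * (z - z')"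
      by (simp add: a(3) algebra_simps)
    ultimately show ?thesis
      using a laurent_extensionI laurentD(2) t_submoduleD(2)[OF I] by metis
  qed
  have "t_ratfun powi k * a = t_ratfun powi k * x + inverse \<delta> * (t_ratfun powi k * z)" for k
    by (simp add: a(3) algebra_simps)
  then show "t_ratfun powi k * a \<in> laurent_extension \<delta> I" for k
    using a laurent_extensionI laurentD(3) t_submoduleD(3)[OF I] by metis
qed

section \<open>Identification of the group and conclusion\<close>

text \<open>Adding an element of \<Lambda> does not change a coset, so the representatives
  \<delta>^-1 f may be enlarged to the submodule \<Lambda> + \<delta>^-1 \<Lambda>, to which the
  criterion for \<open>t_semidirect\<close> applies.\<close>

lemma alexander_semidirect_eq:
  "alexander_semidirect \<Delta> = t_semidirect (laurent_extension (ratfun_of_laurent \<Delta>) laurent_subgroup)"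
proof -
  let ?\<delta> = "ratfun_of_laurent \<Delta>"
  have "laurent_coset ` laurent_extension ?\<delta> laurent_subgroup
      = {laurent_coset (inverse ?\<delta> * ratfun_of_laurent f) | f. True}"
  proof (intro equalityI subsetI)
    fix C assume "C \<in> laurent_coset ` laurent_extension ?\<delta> laurent_subgroup"
    then obtain x f where "x \<in> laurent_subgroup"
      and C: "C = laurent_coset (x + inverse ?\<delta> * ratfun_of_laurent f)"
      by (auto elim!: laurent_extensionE)
    then have "C = laurent_coset (inverse ?\<delta> * ratfun_of_laurent f)"
      unfolding C by (simp add: laurent_coset_eq_iff[OF t_submodule_laurent])
    then show "C \<in> {laurent_coset (inverse ?\<delta> * ratfun_of_laurent f) | f. True}" by blast
  next
    fix C assume "C \<in> {laurent_coset (inverse ?\<delta> * ratfun_of_laurent f) | f. True}"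
    then obtain f where "C = laurent_coset (0 + inverse ?\<delta> * ratfun_of_laurent f)" by auto
    then show "C \<in> laurent_coset ` laurent_extension ?\<delta> laurent_subgroup"
      by (rule ssubst) (intro imageI laurent_extensionI laurentD(1) rangeI)
  qed
  then show ?thesis by (simp add: alexander_semidirect_def inverse_laurent_module_def)
qed

text \<open>The chain consists of \<Lambda> + \<delta>^-1 I with I the ideal (n!, t^(n!) - 1).
  Finite index and trivial action of n! Z carry over from \<Lambda>/I; for nonzero \<delta> the
  intersection is found by multiplying with \<delta> and using divisibility in \<Lambda>.\<close>

lemma residually_finite_laurent_extension:
  assumes \<delta>: "\<delta> \<in> laurent_subgroup"
  shows "residually_finite (t_semidirect (laurent_extension \<delta> laurent_subgroup))"
proof (rule residually_finite_t_semidirect[OF t_submodule_laurent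
      t_submodule_laurent_extension[OF t_submodule_laurent]])
  let ?J = "\<lambda>n. laurent_extension \<delta> (fact_ideal n)"
  show "t_submodule (?J n)" for n
    by (rule t_submodule_laurent_extension[OF t_submodule_fact_ideal])
  show "laurent_subgroup \<subseteq> ?J n" for n
    using laurent_extensionI[OF _ t_submoduleD(1)[OF t_submodule_fact_ideal], of _ \<delta> n] by auto
  show "?J n \<subseteq> laurent_extension \<delta> laurent_subgroup" for n
    using fact_ideal_subset[of n] unfolding laurent_extension_def by blast
  show "?J (Suc n) \<subseteq> ?J n" for n
    using fact_ideal_Suc_subset[of n] unfolding laurent_extension_def by blast
  show "(\<Inter>n. ?J n) \<subseteq> laurent_subgroup"
  \<comment> \<open>With \<open>inverse 0 = 0\<close> every term of the chain is \<Lambda>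
    itself.\<close>
  proof (cases "\<delta> = 0")
    case True
    then show ?thesis unfolding laurent_extension_def by auto
  next
    case False
    show ?thesis
    proof
      fix v assume v: "v \<in> (\<Inter>n. ?J n)"
      have *: "\<exists>x\<in>laurent_subgroup. \<delta> * v - \<delta> * x \<in> fact_ideal n" for n
      proof -
        have "v \<in> ?J n" using v by blast
        then obtain x z where "x \<in> laurent_subgroup" "z \<in> fact_ideal n" "v = x + inverse \<delta> * z"
          by (rule laurent_extensionE)
        moreover from this have "\<delta> * v - \<delta> * x = z" using False by (simp add: algebra_simps)
        ultimately show ?thesis by metis
      qed
      \<comment> \<open>A single level suffices to see that \<delta> v lies in \<Lambda>, since each
        \<open>fact_ideal\<close> does; all levels together then give divisibility by
        \<delta>.\<close>
      obtain x where x: "x \<in> laurent_subgroup" "\<delta> * v - \<delta> * x \<in> fact_ideal 0" using *[of 0] ..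
      have "(\<delta> * v - \<delta> * x) + \<delta> * x \<in> laurent_subgroup"
        by (rule laurentD(5)[OF subsetD[OF fact_ideal_subset x(2)] laurent_mult[OF \<delta> x(1)]])
      then have "\<delta> * v \<in> laurent_subgroup" by simp
      then obtain g where "g \<in> laurent_subgroup" "\<delta> * v = \<delta> * g"
        using laurent_dvd_of_fact_ideal[OF \<delta> False _ *] by blast
      then show "v \<in> laurent_subgroup" using False by simp
    qed
  qed
  show "t_ratfun powi k * v - v \<in> ?J n"
    if k: "int (fact n) dvd k" and v: "v \<in> laurent_extension \<delta> laurent_subgroup" for n k v
  proof -
    obtain x z where xz: "x \<in> laurent_subgroup" "z \<in> laurent_subgroup" "v = x + inverse \<delta> * z"
      using v by (rule laurent_extensionE)
    have "t_ratfun powi k * v - v = (t_ratfun powi k * x - x) + inverse \<delta> * (z * (t_ratfun powi k - 1))"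
      by (simp add: xz(3) algebra_simps)
    also have "\<dots> \<in> ?J n"
      by (rule laurent_extensionI[OF laurentD(2)[OF laurentD(3)[OF xz(1)] xz(1)]
            fact_ideal_mult[OF xz(2) t_powi_minus_1_in_fact_ideal[OF k]]])
    finally show ?thesis .
  qed
  show "\<exists>R. finite R \<and> (\<forall>v\<in>laurent_extension \<delta> laurent_subgroup. \<exists>r\<in>R. v - r \<in> ?J n)" for n
  proof -
    obtain R where R: "finite R" "\<forall>x\<in>laurent_subgroup. \<exists>r\<in>R. x - r \<in> fact_ideal n"
      using laurent_mod_fact_ideal_finite[of n] by (elim exE conjE)
    have "\<exists>r\<in>(\<lambda>r. inverse \<delta> * r) ` R. v - r \<in> ?J n" if v: "v \<in> laurent_extension \<delta> laurent_subgroup" for v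
    proof -
      obtain x z where xz: "x \<in> laurent_subgroup" "z \<in> laurent_subgroup" "v = x + inverse \<delta> * z"
        using v by (rule laurent_extensionE)
      obtain r where r: "r \<in> R" "z - r \<in> fact_ideal n" using bspec[OF R(2) xz(2)] ..
      have "v - inverse \<delta> * r = x + inverse \<delta> * (z - r)" by (simp add: xz(3) algebra_simps)
      also have "\<dots> \<in> ?J n" by (rule laurent_extensionI[OF xz(1) r(2)])
      finally show ?thesis using r(1) by blast
    qed
    then show ?thesis using R(1) by (intro exI[of _ "(\<lambda>r. inverse \<delta> * r) ` R"] conjI ballI finite_imageI)
  qed
qed

theorem lemma4p4:
  fixes K :: "(real^4) set" and \<Delta> :: laurent
  assumes "knot K" and "alexander_polynomial K \<Delta>"
  shows "residually_finite (alexander_semidirect \<Delta>)"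
  unfolding alexander_semidirect_eq by (rule residually_finite_laurent_extension) simp

end
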